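(* Let $f_1,\dots,f_N:\mathbb R\to\mathbb R$ be differentiable and strongly convex with Lipschitz continuous derivatives, and let $\rho>0$. Suppose the hypergraph on nodes $v_1,\dots,v_N$ has exactly one hyperedge, and it contains all nodes. Then H-CADMM reduces to C-CADMM: if H-CADMM is run from $\mathbf x^0$, $\mathbf z^0=\mathbf E^{-1}\mathbf C^\top\mathbf x^0$, $\mathbf y^0$ and C-CADMM is run from the same $\mathbf x^0$ with $\boldsymbol\lambda^0=\mathbf y^0$, then for all $k\ge0$ the $\mathbf x^k$ iterates of the two methods coincide, $\mathbf y^k=\boldsymbol\lambda^k$, and $z^k=\bar x^k$.
   Context: H-CADMM: for a hypergraph with vertices $v_1,\dots,v_N$ and hyperedges $\mathcal E_1,\dots,\mathcal E_M$ (each with at least two vertices), let $\mathbf C\in\mathbb R^{N\times M}$ be the incidence matrix ($C_{ij}=1$ if $v_i\in\mathcal E_j$, else $0$), $\mathbf D$ the diagonal matrix of node degrees (number of hyperedges containing $v_i$), $\mathbf E$ the diagonal matrix with $E_{jj}=|\mathcal E_j|$. With $F(\mathbf x)=\sum_if_i(x_i)$, the iteration is: $\mathbf x^{k+1}$ is the unique solution of $\nabla F(\mathbf x^{k+1})+\rho\mathbf D\mathbf x^{k+1}=\rho\mathbf C\mathbf z^k-\mathbf y^k$; $\mathbf z^{k+1}=\mathbf E^{-1}\mathbf C^\top\mathbf x^{k+1}$; $\mathbf y^{k+1}=\mathbf y^k+\rho(\mathbf D\mathbf x^{k+1}-\mathbf C\mathbf z^{k+1})$. C-CADMM (centralized consensus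 ADMM): with $\bar x^k=\frac1N\sum_{i=1}^Nx_i^k$, for each $i$, $x_i^{k+1}$ is the unique solution of $f_i'(x_i^{k+1})+\rho x_i^{k+1}=\rho\bar x^k-\lambda_i^k$, and $\lambda_i^{k+1}=\lambda_i^k+\rho(x_i^{k+1}-\bar x^{k+1})$. *)

theory Defs
  imports "HOL-Analysis.Analysis"
begin

definition strongly_convex_on :: "real \<Rightarrow> 'a::real_normed_vector set \<Rightarrow> ('a \<Rightarrow> real) \<Rightarrow> bool" where
  "strongly_convex_on \<mu> S f \<longleftrightarrow> 0 < \<mu> \<and> convex S \<and>
     (\<forall>x\<in>S. \<forall>y\<in>S. \<forall>u\<ge>0. \<forall>v\<ge>0. u + v = 1 \<longrightarrow>
        f (u *\<^sub>R x + v *\<^sub>R y) \<le> u * f x + v * f y - \<mu> / 2 * u * v * (norm (x - y))\<^sup>2)"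

definition gradient :: "('a::real_inner \<Rightarrow> real) \<Rightarrow> 'a \<Rightarrow> 'a" where
  "gradient F x = (THE g. GDERIV F x :> g)"

text \<open>
  The nodes of a hypergraph are the elements of the finite type \<open>'n\<close> (so \<open>N = CARD('n)\<close>),
  and its hyperedges are the sets \<open>H j\<close>, where \<open>j\<close> ranges over the finite index type \<open>'m\<close>
  (so \<open>M = CARD('m)\<close>). Repeated hyperedges are allowed.
\<close>

definition hypergraph :: "('m::finite \<Rightarrow> 'n::finite set) \<Rightarrow> bool" where
  "hypergraph H \<longleftrightarrow> (\<forall>j. 2 \<le> card (H j))"

definition incidence_mat :: "('m::finite \<Rightarrow> 'n::finite set) \<Rightarrow> real^'m^'n" where
  "incidence_mat H = (\<chi> i j. if i \<in> H j then 1 else 0)"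

definition node_degree_mat :: "('m::finite \<Rightarrow> 'n::finite set) \<Rightarrow> real^'n^'n" where
  "node_degree_mat H = (\<chi> i i'. if i = i' then real (card {j. i \<in> H j}) else 0)"

definition edge_degree_mat :: "('m::finite \<Rightarrow> 'n::finite set) \<Rightarrow> real^'m^'m" where
  "edge_degree_mat H = (\<chi> j j'. if j = j' then real (card (H j)) else 0)"

definition separable_sum :: "('n::finite \<Rightarrow> real \<Rightarrow> real) \<Rightarrow> real^'n \<Rightarrow> real" where
  "separable_sum f x = (\<Sum>i\<in>UNIV. f i (x $ i))"

definition edge_average :: "('m::finite \<Rightarrow> 'n::finite set) \<Rightarrow> real^'n \<Rightarrow> real^'m" where
  "edge_average H x = matrix_inv (edge_degree_mat H) *v (transpose (incidence_mat H) *v x)"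

definition node_average :: "real^'n::finite \<Rightarrow> real" where
  "node_average x = (1 / real CARD('n)) * (\<Sum>i\<in>UNIV. x $ i)"

text \<open>
  In both methods the primal update is the unique solution of an equation, rendered by a
  definite description. For differentiable, strongly convex \<open>f i\<close> and \<open>\<rho> > 0\<close> the solution
  exists and is unique, since the left-hand side is continuous and strongly monotone.
  The predicates only constrain the updates; initial values are left to the user.
\<close>

definition hcadmm_iterates ::
  "('n::finite \<Rightarrow> real \<Rightarrow> real) \<Rightarrow> ('m::finite \<Rightarrow> 'n set) \<Rightarrow> real \<Rightarrow>
   (nat \<Rightarrow> real^'n) \<Rightarrow> (nat \<Rightarrow> real^'m) \<Rightarrow> (nat \<Rightarrow> real^'n) \<Rightarrow> bool" where
  "hcadmm_iterates f H \<rho> x z y \<longleftrightarrow> (\<forall>k.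
     x (Suc k) = (THE u. gradient (separable_sum f) u + \<rho> *\<^sub>R (node_degree_mat H *v u)
                         = \<rho> *\<^sub>R (incidence_mat H *v z k) - y k) \<and>
     z (Suc k) = edge_average H (x (Suc k)) \<and>
     y (Suc k) = y k + \<rho> *\<^sub>R (node_degree_mat H *v x (Suc k) - incidence_mat H *v z (Suc k)))"

definition ccadmm_iterates ::
  "('n::finite \<Rightarrow> real \<Rightarrow> real) \<Rightarrow> real \<Rightarrow> (nat \<Rightarrow> real^'n) \<Rightarrow> (nat \<Rightarrow> real^'n) \<Rightarrow> bool" where
  "ccadmm_iterates f \<rho> x l \<longleftrightarrow> (\<forall>k i.
     x (Suc k) $ i = (THE t. deriv (f i) t + \<rho> * t = \<rho> * node_average (x k) - l k $ i) \<and>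
     l (Suc k) $ i = l k $ i + \<rho> * (x (Suc k) $ i - node_average (x (Suc k))))"

end

theory Submission
  imports Defs
begin

text \<open>
  With a single hyperedge containing every node, \<open>D\<close> is the identity, \<open>C z\<close> is the constant vector
  with entry \<open>z\<close>, and \<open>E\<^sup>-\<^sup>1 C\<^sup>T x\<close> is the mean of \<open>x\<close>. The gradient of \<open>F\<close> acts componentwise, so the
  vector equation of H-CADMM splits into the scalar equations of C-CADMM. To split its definite
  description as well, the scalar equations must be uniquely solvable: \<open>deriv (f i)\<close> is continuous
  and monotone, so adding \<open>\<rho> t\<close> makes it a strictly increasing bijection.
\<close>

lemma strongly_convex_on_imp_convex_on:
  assumes "strongly_convex_on \<mu> S f"
  shows "convex_on S f"
  unfolding convex_on_def
proof (intro conjI ballI allI impI)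
  show "convex S" using assms by (simp add: strongly_convex_on_def)
next
  fix u v :: real and a b
  assume *: "a \<in> S" "b \<in> S" "0 \<le> u" "0 \<le> v" "u + v = 1"
  then have "f (u *\<^sub>R a + v *\<^sub>R b) \<le> u * f a + v * f b - \<mu> / 2 * u * v * (norm (a - b))\<^sup>2"
    using assms by (simp add: strongly_convex_on_def)
  moreover have "0 \<le> \<mu> / 2 * u * v * (norm (a - b))\<^sup>2"
    using assms * by (simp add: strongly_convex_on_def)
  ultimately show "f (u *\<^sub>R a + v *\<^sub>R b) \<le> u * f a + v * f b" by linarith
qed

text \<open>The graph lies above its tangents at \<open>s\<close> and at \<open>t\<close>; adding
  the two tangent inequalities cancels the function values.\<close>

lemma convex_on_deriv_mono:
  fixes f :: "real \<Rightarrow> real"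
  assumes "convex_on UNIV f" "f differentiable_on UNIV" "s \<le> t"
  shows "deriv f s \<le> deriv f t"
proof (cases "s = t")
  case False
  have D: "(f has_real_derivative deriv f a) (at a within UNIV)" for a
    using assms(2) by (simp add: differentiable_on_def DERIV_deriv_iff_real_differentiable)
  have tangent: "deriv f a * (b - a) \<le> f b - f a" for a b
    using convex_on_imp_above_tangent[OF assms(1) _ _ _ D] by simp
  from tangent[of s t] tangent[of t s] have "deriv f s * (t - s) \<le> deriv f t * (t - s)"
    by (simp add: algebra_simps)
  with False assms(3) show ?thesis by simp
qed simp

text \<open>The linear term makes the left-hand side strictly increasing, hence injective, and
  unbounded in both directions, so the intermediate value theorem gives a solution.\<close>

lemma ex1_mono_add_linear:
  fixes g :: "real \<Rightarrow> real"
  assumes cont: "continuous_on UNIV g" and mono: "mono g" and \<rho>: "0 < \<rho>"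
  shows "\<exists>!t. g t + \<rho> * t = c"
proof -
  define h where "h t = g t + \<rho> * t" for t
  have strict: "h s < h t" if "s < t" for s t
    using that \<rho> monoD[OF mono, of s t] by (simp add: h_def add_le_less_mono)
  \<comment> \<open>Chosen so that the linear term at \<open>b\<close> and \<open>- b\<close>
    already covers the gap between \<open>g 0\<close> and \<open>c\<close>; monotonicity of
    \<open>g\<close> only helps.\<close>
  define b where "b = \<bar>c - g 0\<bar> / \<rho>"
  have b: "0 \<le> b" "\<rho> * b = \<bar>c - g 0\<bar>" using \<rho> by (auto simp: b_def)
  have "h (- b) \<le> c" "c \<le> h b"
    using monoD[OF mono, of "- b" 0] monoD[OF mono, of 0 b] b by (auto simp: h_def)
  moreover have "continuous_on {- b..b} h"
    unfolding h_def by (intro continuous_intros continuous_on_subset[OF cont]) auto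
  ultimately obtain t where "h t = c"
    using IVT'[of h "- b" c b] b(1) by auto
  moreover have "s = t'" if "h s = h t'" for s t'
    using strict[of s t'] strict[of t' s] that by (cases s t' rule: linorder_cases) auto
  ultimately show ?thesis unfolding h_def by metis
qed

lemma gradient_eqI:
  assumes "GDERIV F x :> g"
  shows "gradient F x = g"
  unfolding gradient_def
proof (rule the_equality)
  show "GDERIV F x :> g" by (rule assms)
next
  fix g' assume "GDERIV F x :> g'"
  then have "(\<lambda>h. inner h g') = (\<lambda>h. inner h g)"
    using assms unfolding gderiv_def by (rule has_derivative_unique)
  \<comment> \<open>Both vectors represent the same functional, which is evaluated here at their
    difference.\<close>
  then have "inner (g' - g) (g' - g) = 0"
    by (metis inner_diff_right right_minus_eq)
  then show "g' = g" by simp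
qed

lemma gradient_separable_sum:
  assumes "\<And>i. f i differentiable_on UNIV"
  shows "gradient (separable_sum f) u = (\<chi> i. deriv (f i) (u $ i))"
proof -
  have "((\<lambda>u. f i (u $ i)) has_derivative (\<lambda>h. deriv (f i) (u $ i) * h $ i)) (at u)" for i
  proof -
    have "(f i has_derivative (\<lambda>h. deriv (f i) (u $ i) * h)) (at (u $ i))"
      using assms[of i] by (simp add: differentiable_on_def has_field_derivative_def
          flip: DERIV_deriv_iff_real_differentiable)
    from has_derivative_compose[OF bounded_linear_imp_has_derivative[OF bounded_linear_vec_nth] this]
    show ?thesis .
  qed
  then have "GDERIV (separable_sum f) u :> (\<chi> i. deriv (f i) (u $ i))"
    unfolding gderiv_def separable_sum_def [abs_def] inner_vec_def
    by (auto intro!: derivative_eq_intros simp: mult.commute)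
  then show ?thesis
    by (rule gradient_eqI)
qed

text \<open>The edge degree matrix is diagonal with nonzero entries, so its inverse is the diagonal
  matrix of reciprocals.\<close>

lemma edge_average_component:
  assumes "\<And>j. H j \<noteq> {}"
  shows "edge_average H x $ j = (\<Sum>i\<in>H j. x $ i) / real (card (H j))"
proof -
  let ?E = "edge_degree_mat H"
  define E' :: "real^'a^'a" where "E' = (\<chi> j j'. if j = j' then 1 / real (card (H j)) else 0)"
  have pos: "card (H j) \<noteq> 0" for j using assms by simp
  have "?E ** E' = mat 1" "E' ** ?E = mat 1"
    using pos by (auto simp: vec_eq_iff matrix_matrix_mult_def edge_degree_mat_def E'_def mat_def
        if_distrib[of "\<lambda>a. a * _"] cong: if_cong)
  \<comment> \<open>\<open>matrix_inv\<close> is a choice among two-sided inverses; associativity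
    shows that there is only one.\<close>
  then have "matrix_inv ?E = E'"
    unfolding matrix_inv_def
    by (intro some_equality conjI) (metis matrix_mul_assoc matrix_mul_lid matrix_mul_rid)+
  then show ?thesis
    by (simp add: edge_average_def matrix_vector_mult_def E'_def transpose_def incidence_mat_def
        if_distrib[of "\<lambda>a. a * _"] sum.If_cases cong: if_cong)
qed

text \<open>Unique solvability in each coordinate makes the vector of scalar solutions the only
  vector solution, so both definite descriptions denote actual solutions.\<close>

lemma the_vec_componentwise:
  fixes P :: "'n::finite \<Rightarrow> 'a \<Rightarrow> bool"
  assumes "\<And>i. \<exists>!t. P i t"
  shows "(THE u::'a^'n. \<forall>i. P i (u $ i)) = (\<chi> i. THE t. P i t)"
proof (rule the_equality)
  show "\<forall>i. P i ((\<chi> i. THE t. P i t) $ i)" using theI'[OF assms] by simp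
next
  fix u :: "'a^'n" assume "\<forall>i. P i (u $ i)"
  then show "u = (\<chi> i. THE t. P i t)"
    using the1_equality[OF assms] by (metis vec_lambda_unique)
qed

theorem proposition1:
  fixes f :: "'n::finite \<Rightarrow> real \<Rightarrow> real"
    and H :: "'m::finite \<Rightarrow> 'n set"
    and \<rho> :: real
    and x y x' l :: "nat \<Rightarrow> real^'n"
    and z :: "nat \<Rightarrow> real^'m"
  assumes differentiable: "\<And>i. f i differentiable_on UNIV"
    and strongly_convex: "\<And>i. \<exists>\<mu>. strongly_convex_on \<mu> UNIV (f i)"
    and lipschitz_deriv: "\<And>i. \<exists>L. L-lipschitz_on UNIV (deriv (f i))"
    and rho_pos: "0 < \<rho>"
    and hypergraph: "hypergraph H"
    and one_hyperedge: "CARD('m) = 1"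
    and all_nodes: "\<And>j. H j = UNIV"
    and hcadmm: "hcadmm_iterates f H \<rho> x z y"
    and hcadmm_init: "z 0 = edge_average H (x 0)"
    and ccadmm: "ccadmm_iterates f \<rho> x' l"
    and ccadmm_init: "x' 0 = x 0" "l 0 = y 0"
  shows "\<forall>k. x k = x' k \<and> y k = l k \<and> (\<forall>j. z k $ j = node_average (x' k))"
proof -
  obtain j0 :: 'm where UNIV_m: "UNIV = {j0}"
    using one_hyperedge card_1_singletonE by blast
  have edge: "edge_average H u $ j = node_average u" for u j
    by (simp add: edge_average_component all_nodes node_average_def)
  have deg: "node_degree_mat H *v u = u" for u
    by (simp add: vec_eq_iff matrix_vector_mult_def node_degree_mat_def all_nodes one_hyperedge
        if_distrib[of "\<lambda>a. a * _"] cong: if_cong)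
  have inc: "(incidence_mat H *v w) $ i = w $ j0" for w i
    by (simp add: matrix_vector_mult_def incidence_mat_def all_nodes UNIV_m)
  \<comment> \<open>The Lipschitz bound supplies continuity of the derivative, convexity its
    monotonicity.\<close>
  have ex1: "\<exists>!t. deriv (f i) t + \<rho> * t = c" for i c
  proof (rule ex1_mono_add_linear[OF _ _ rho_pos])
    show "continuous_on UNIV (deriv (f i))"
      using lipschitz_deriv[of i] lipschitz_on_continuous_on by blast
    show "mono (deriv (f i))"
      using strongly_convex[of i] differentiable[of i]
      by (blast intro: monoI convex_on_deriv_mono strongly_convex_on_imp_convex_on)
  qed
  have primal: "(THE u. gradient (separable_sum f) u + \<rho> *\<^sub>R (node_degree_mat H *v u)
        = \<rho> *\<^sub>R (incidence_mat H *v w) - v)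
      = (\<chi> i. THE t. deriv (f i) t + \<rho> * t = \<rho> * w $ j0 - v $ i)" for w v
    using the_vec_componentwise[of "\<lambda>i t. deriv (f i) t + \<rho> * t = \<rho> * w $ j0 - v $ i", OF ex1]
    by (simp add: gradient_separable_sum[OF differentiable] deg inc vec_eq_iff)
  have "x k = x' k \<and> y k = l k \<and> (\<forall>j. z k $ j = node_average (x' k))" for k
  proof (induction k)
    case 0
    then show ?case using hcadmm_init ccadmm_init by (simp add: edge)
  next
    case (Suc k)
    \<comment> \<open>By the induction hypothesis \<open>z k $ j0\<close> is the mean of
      \<open>x' k\<close>, so both methods solve the same scalar equations. The new \<open>z\<close>
      and then the new \<open>y\<close> follow from this equality.\<close>
    have x: "x (Suc k) = x' (Suc k)"
      using hcadmm ccadmm Suc unfolding hcadmm_iterates_def ccadmm_iterates_def primal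
      by (simp add: vec_eq_iff)
    moreover have z: "z (Suc k) $ j = node_average (x' (Suc k))" for j
      using hcadmm x by (simp add: hcadmm_iterates_def edge)
    moreover have "y (Suc k) = l (Suc k)"
      using hcadmm ccadmm Suc x z
      unfolding hcadmm_iterates_def ccadmm_iterates_def
      by (simp add: vec_eq_iff deg inc)
    ultimately show ?case by blast
  qed
  then show ?thesis by blast
qed

end
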